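(* Let $\kappa$ be a regular uncountable cardinal with $\kappa^{<\kappa}=\kappa$. If $X$ is a (Hausdorff, regular) $\kappa$-dynamic strong $\kappa$-Choquet space of weight $\le\kappa$, then player II has a winning tactic in the $\kappa$-dynamic strong $\kappa$-Choquet game on $X$.
   Context: The $\kappa$-dynamic strong $\kappa$-Choquet game on $X$: players I and II alternate for $\kappa$ rounds; in round $\alpha$, I plays a point $x_\alpha$ and a set $U_\alpha\ni x_\alpha$ which is the intersection of fewer than $\kappa$ many open sets, intersected with $\bigcap_{\beta<\alpha}U_\beta$; II then plays $V_\alpha\ni x_\alpha$ which is the intersection of fewer than $\kappa$ many open sets, intersected with $U_\alpha$. II wins if $\bigcap_{\alpha<\gamma}U_\alpha\neq\emptyset$ for every limit $\gamma\le\kappa$. $X$ is $\kappa$-dynamic strong $\kappa$-Choquet if II has a winning strategy. A tactic for player II is a strategy whose response depends only on the most recent move of player I.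
   Formalization: In the game, player I's set U_α is taken relative to the intersection of II's earlier sets V_β, as in standard Choquet games, not of the earlier U_β; with the U_β, II's moves would not matter and no infinite Hausdorff space would be κ-dynamic strong κ-Choquet. *)

theory Defs
  imports "HOL-Analysis.Analysis"
begin

unbundle cardinal_syntax

text \<open>
  The cardinal \<open>\<kappa>\<close> is a cardinal order, as in the cardinals library. An ordinal \<open>\<alpha> < \<kappa>\<close> is an
  element of \<open>Field \<kappa>\<close>, the ordinals \<open>\<beta> < \<alpha>\<close> are \<open>underS \<kappa> \<alpha>\<close>, and an ordinal \<open>\<gamma> \<le> \<kappa>\<close> is
  identified with the initial segment of its predecessors (\<open>\<kappa>\<close> itself being \<open>Field \<kappa>\<close>).
\<close>

definition limit_segment :: "'k rel \<Rightarrow> 'k set \<Rightarrow> bool" where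
  "limit_segment \<kappa> \<gamma> \<longleftrightarrow>
     ofilter \<kappa> \<gamma> \<and> \<gamma> \<noteq> {} \<and> (\<forall>\<alpha>\<in>\<gamma>. \<exists>\<beta>\<in>\<gamma>. \<alpha> \<in> underS \<kappa> \<beta>)"

text \<open>The set of all sequences of length \<open>< \<kappa>\<close> in \<open>\<kappa>\<close>, whose cardinality is \<open>\<kappa>\<^sup><\<^sup>\<kappa>\<close>.\<close>

definition short_sequences :: "'k rel \<Rightarrow> ('k \<rightharpoonup> 'k) set" where
  "short_sequences \<kappa> = {s. (\<exists>\<alpha>\<in>Field \<kappa>. dom s = underS \<kappa> \<alpha>) \<and> ran s \<subseteq> Field \<kappa>}"

definition base_of :: "'a topology \<Rightarrow> 'a set set \<Rightarrow> bool" where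
  "base_of X \<B> \<longleftrightarrow> openin X = arbitrary union_of (\<lambda>B. B \<in> \<B>)"

definition weight_le :: "'a topology \<Rightarrow> 'k rel \<Rightarrow> bool" where
  "weight_le X \<kappa> \<longleftrightarrow> (\<exists>\<B>. base_of X \<B> \<and> |\<B>| \<le>o \<kappa>)"

text \<open>Intersections of fewer than \<open>\<kappa>\<close> many open sets, the empty intersection being the whole space.\<close>

definition short_Inter_open :: "'k rel \<Rightarrow> 'a topology \<Rightarrow> 'a set \<Rightarrow> bool" where
  "short_Inter_open \<kappa> X G \<longleftrightarrow>
     (\<exists>\<O>. |\<O>| <o \<kappa> \<and> (\<forall>W\<in>\<O>. openin X W) \<and> G = topspace X \<inter> \<Inter>\<O>)"

text \<open>
  The dynamic strong Choquet game. A play is recorded by the points \<open>x\<close> and sets \<open>U\<close> of player I and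
  the sets \<open>V\<close> of player II. As in every Choquet game, I has to play inside all the earlier answers
  of II: the set \<open>U \<alpha>\<close> is relative to the intersection of the earlier \<open>V \<beta>\<close>. (If it were only
  relative to the earlier \<open>U \<beta>\<close>, the moves of II would have no influence on the game. At limit
  rounds the two intersections coincide.)
\<close>

definition legal_I ::
    "'k rel \<Rightarrow> 'a topology \<Rightarrow> ('k \<Rightarrow> 'a) \<Rightarrow> ('k \<Rightarrow> 'a set) \<Rightarrow> ('k \<Rightarrow> 'a set) \<Rightarrow> 'k \<Rightarrow> bool" where
  "legal_I \<kappa> X x U V \<alpha> \<longleftrightarrow>
     x \<alpha> \<in> U \<alpha> \<and> (\<exists>G. short_Inter_open \<kappa> X G \<and> U \<alpha> = G \<inter> (\<Inter>\<beta>\<in>underS \<kappa> \<alpha>. V \<beta>))"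

definition legal_II ::
    "'k rel \<Rightarrow> 'a topology \<Rightarrow> ('k \<Rightarrow> 'a) \<Rightarrow> ('k \<Rightarrow> 'a set) \<Rightarrow> ('k \<Rightarrow> 'a set) \<Rightarrow> 'k \<Rightarrow> bool" where
  "legal_II \<kappa> X x U V \<alpha> \<longleftrightarrow>
     x \<alpha> \<in> V \<alpha> \<and> (\<exists>G. short_Inter_open \<kappa> X G \<and> V \<alpha> = G \<inter> U \<alpha>)"

text \<open>
  A strategy of II sees the round \<open>\<alpha>\<close>, the moves of I up to and including round \<open>\<alpha>\<close>, and the moves
  of II before round \<open>\<alpha>\<close>.
\<close>

type_synonym ('k, 'a) strategy =
  "'k \<Rightarrow> ('k \<Rightarrow> 'a) \<Rightarrow> ('k \<Rightarrow> 'a set) \<Rightarrow> ('k \<Rightarrow> 'a set) \<Rightarrow> 'a set"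

definition follows ::
    "'k rel \<Rightarrow> ('k, 'a) strategy \<Rightarrow> ('k \<Rightarrow> 'a) \<Rightarrow> ('k \<Rightarrow> 'a set) \<Rightarrow> ('k \<Rightarrow> 'a set) \<Rightarrow> 'k \<Rightarrow> bool" where
  "follows \<kappa> \<sigma> x U V \<alpha> \<longleftrightarrow>
     V \<alpha> = \<sigma> \<alpha> (restrict x (under \<kappa> \<alpha>)) (restrict U (under \<kappa> \<alpha>)) (restrict V (underS \<kappa> \<alpha>))"

text \<open>
  All partial plays, of any length \<open>\<delta> \<le> \<kappa>\<close>, are considered: if the intersection is empty at some limit
  \<open>\<gamma> < \<kappa>\<close>, then I cannot move in round \<open>\<gamma>\<close> and the play ends there, lost by II.
\<close>

definition winning_strategy :: "'k rel \<Rightarrow> 'a topology \<Rightarrow> ('k, 'a) strategy \<Rightarrow> bool" where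
  "winning_strategy \<kappa> X \<sigma> \<longleftrightarrow>
     (\<forall>\<delta> x U V.
        ofilter \<kappa> \<delta> \<and> (\<forall>\<alpha>\<in>\<delta>. legal_I \<kappa> X x U V \<alpha> \<and> follows \<kappa> \<sigma> x U V \<alpha>) \<longrightarrow>
        (\<forall>\<alpha>\<in>\<delta>. legal_II \<kappa> X x U V \<alpha>) \<and>
        (\<forall>\<gamma>\<subseteq>\<delta>. limit_segment \<kappa> \<gamma> \<longrightarrow> (\<Inter>\<alpha>\<in>\<gamma>. U \<alpha>) \<noteq> {}))"

definition dynamic_strong_Choquet :: "'k rel \<Rightarrow> 'a topology \<Rightarrow> bool" where
  "dynamic_strong_Choquet \<kappa> X \<longleftrightarrow> (\<exists>\<sigma>. winning_strategy \<kappa> X \<sigma>)"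

(* A strategy of this form is called a tactic; note that tau does not see the round number either. *)

definition stationary :: "'k rel \<Rightarrow> ('k, 'a) strategy \<Rightarrow> bool" where
  "stationary \<kappa> \<sigma> \<longleftrightarrow> (\<exists>\<tau>. \<forall>\<alpha>\<in>Field \<kappa>. \<forall>x U V. \<sigma> \<alpha> x U V = \<tau> (x \<alpha>) (U \<alpha>))"

end

theory Submission
  imports Defs
begin

text \<open>
  Refine the topology by making intersections of fewer than \<open>\<kappa>\<close> open sets open. Since
  \<open>\<kappa>\<^sup><\<^sup>\<kappa> = \<kappa>\<close> and \<open>X\<close> is regular, the new topology has a clopen base \<open>c \<xi>\<close> indexed by \<open>\<kappa>\<close>.
  By recursion on \<open>\<alpha> < \<kappa>\<close> one builds a tree of partitions into open cells, each cell carrying a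
  partial play that follows the given winning strategy; the cells of level \<open>\<alpha>\<close> are contained in
  \<open>c \<alpha>\<close> or disjoint from it, so the cells form a base. The strategy being winning, all branches
  of the tree have nonempty intersection. Hence II wins by remembering nothing and playing inside
  a cell of the current point that is contained in the current set of I: the cells met during
  a play lie on one branch.
\<close>

section \<open>Short intersections of open sets, and locality of the rules of the game\<close>

lemma short_Inter_open_subset: "short_Inter_open \<kappa> X G \<Longrightarrow> G \<subseteq> topspace X"
  by (auto simp: short_Inter_open_def)

text \<open>Regularity of \<kappa> bounds the union of the defining families. The factor
  \<open>topspace X\<close> gives the empty index set its conventional value.\<close>

lemma short_Inter_open_INT:
  assumes "Cinfinite \<kappa>" "regularCard \<kappa>" "|I| <o \<kappa>" "\<And>i. i \<in> I \<Longrightarrow> short_Inter_open \<kappa> X (G i)"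
  shows "short_Inter_open \<kappa> X (topspace X \<inter> (\<Inter>i\<in>I. G i))"
proof -
  have "\<forall>i\<in>I. \<exists>\<O>. |\<O>| <o \<kappa> \<and> (\<forall>W\<in>\<O>. openin X W) \<and> G i = topspace X \<inter> \<Inter>\<O>"
    using assms(4) unfolding short_Inter_open_def by blast
  then obtain \<O> where \<O>: "\<And>i. i \<in> I \<Longrightarrow>
      |\<O> i| <o \<kappa> \<and> (\<forall>W\<in>\<O> i. openin X W) \<and> G i = topspace X \<inter> \<Inter>(\<O> i)"
    by metis
  have "|\<Union>i\<in>I. \<O> i| <o \<kappa>"
    using card_of_UNION_ordLess_infinite_Field_regularCard[OF assms(2,1,3)] \<O> by blast
  moreover have "topspace X \<inter> (\<Inter>i\<in>I. G i) = topspace X \<inter> \<Inter>(\<Union>i\<in>I. \<O> i)"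
    using \<O> by auto
  ultimately show ?thesis
    unfolding short_Inter_open_def using \<O> by (intro exI[of _ "\<Union>i\<in>I. \<O> i"]) blast
qed

lemma finite_ordLess_Cinfinite: "Cinfinite \<kappa> \<Longrightarrow> finite A \<Longrightarrow> |A| <o \<kappa>"
  by (rule finite_ordLess_infinite)
     (auto simp: cinfinite_def card_of_well_order_on Field_card_of dest: card_order_on_well_order_on)

lemma openin_short_Inter_open:
  assumes "Cinfinite \<kappa>" "openin X W"
  shows "short_Inter_open \<kappa> X W"
  using finite_ordLess_Cinfinite[OF assms(1), of "{W}"] assms(2) openin_subset[OF assms(2)]
  unfolding short_Inter_open_def by (intro exI[of _ "{W}"]) auto

lemma short_Inter_open_Int:
  assumes "Cinfinite \<kappa>" "regularCard \<kappa>" "short_Inter_open \<kappa> X G" "short_Inter_open \<kappa> X H"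
  shows "short_Inter_open \<kappa> X (G \<inter> H)"
proof -
  have "G \<inter> H = topspace X \<inter> (\<Inter>b\<in>{True, False}. if b then G else H)"
    using short_Inter_open_subset[OF assms(3)] by auto
  moreover have "short_Inter_open \<kappa> X \<dots>"
    using assms by (intro short_Inter_open_INT finite_ordLess_Cinfinite) auto
  ultimately show ?thesis by simp
qed

text \<open>Round \<alpha> only reads the history up to \<alpha>, so histories agreeing there can be
  exchanged. The first premise is reflexivity of the order at \<alpha>.\<close>

lemma legal_I_cong:
  assumes "\<alpha> \<in> under \<kappa> \<alpha>"
    and "\<And>\<beta>. \<beta> \<in> under \<kappa> \<alpha> \<Longrightarrow> x \<beta> = x' \<beta> \<and> U \<beta> = U' \<beta> \<and> V \<beta> = V' \<beta>"
  shows "legal_I \<kappa> X x U V \<alpha> = legal_I \<kappa> X x' U' V' \<alpha>"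
proof -
  have "V \<beta> = V' \<beta>" if "\<beta> \<in> underS \<kappa> \<alpha>" for \<beta>
    using that assms(2) by (auto simp: underS_def under_def)
  then show ?thesis
    unfolding legal_I_def using assms by simp
qed

lemma follows_cong:
  assumes "\<alpha> \<in> under \<kappa> \<alpha>"
    and "\<And>\<beta>. \<beta> \<in> under \<kappa> \<alpha> \<Longrightarrow> x \<beta> = x' \<beta> \<and> U \<beta> = U' \<beta> \<and> V \<beta> = V' \<beta>"
  shows "follows \<kappa> \<sigma> x U V \<alpha> = follows \<kappa> \<sigma> x' U' V' \<alpha>"
proof -
  have "restrict x (under \<kappa> \<alpha>) = restrict x' (under \<kappa> \<alpha>)"
    "restrict U (under \<kappa> \<alpha>) = restrict U' (under \<kappa> \<alpha>)"
    "restrict V (underS \<kappa> \<alpha>) = restrict V' (underS \<kappa> \<alpha>)"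
    using assms(2) by (auto intro!: restrict_ext simp: underS_def under_def)
  then show ?thesis
    unfolding follows_def using assms by simp
qed

section \<open>A base of \<kappa> many closed short intersections\<close>

lemma openin_base_of: "base_of X \<B> \<Longrightarrow> B \<in> \<B> \<Longrightarrow> openin X B"
  by (auto simp: base_of_def arbitrary_union_of_alt)

text \<open>In a regular space, the sets with \<open>x \<in> B n\<close> and \<open>cl (B (n+1)) \<subseteq> B n\<close> have a closed intersection.\<close>

lemma regular_space_closed_Inter:
  assumes reg: "regular_space X" and base: "base_of X \<B>" and "openin X W" "x \<in> W"
  obtains \<S> where "countable \<S>" "\<S> \<subseteq> \<B>" "x \<in> \<Inter>\<S>" "closedin X (topspace X \<inter> \<Inter>\<S>)"
    "topspace X \<inter> \<Inter>\<S> \<subseteq> W"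
proof -
  have nbhd: "\<exists>B C. B \<in> \<B> \<and> closedin X C \<and> x \<in> B \<and> B \<subseteq> C \<and> C \<subseteq> W'"
    if "openin X W'" "x \<in> W'" for W'
  proof -
    have "\<exists>U C. openin X U \<and> closedin X C \<and> x \<in> U \<and> U \<subseteq> C \<and> C \<subseteq> W'"
      using reg that by (simp add: neighbourhood_base_of flip: neighbourhood_base_of_closedin)
    then obtain U C where UC: "openin X U" "closedin X C" "x \<in> U" "U \<subseteq> C" "C \<subseteq> W'"
      by auto
    then obtain B where "B \<in> \<B>" "x \<in> B" "B \<subseteq> U"
      using base unfolding base_of_def arbitrary_union_of_alt fun_eq_iff by metis
    then show ?thesis using UC by blast
  qed
  note openB = openin_base_of[OF base]
  let ?P = "\<lambda>(B, C). B \<in> \<B> \<and> closedin X C \<and> x \<in> B \<and> B \<subseteq> C"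
  \<comment> \<open>The guard \<open>n = 0\<close> starts the sequence inside \<open>W\<close>;
    afterwards it holds vacuously and the link condition takes over.\<close>
  have "\<exists>f. \<forall>n. (?P (f n) \<and> (n = (0::nat) \<longrightarrow> snd (f n) \<subseteq> W)) \<and> snd (f (Suc n)) \<subseteq> fst (f n)"
  proof (rule dependent_nat_choice)
    show "\<exists>p. ?P p \<and> ((0::nat) = 0 \<longrightarrow> snd p \<subseteq> W)"
      using nbhd[OF assms(3,4)] by auto
  next
    fix p n assume "?P p \<and> (n = (0::nat) \<longrightarrow> snd p \<subseteq> W)"
    then show "\<exists>q. (?P q \<and> (Suc n = 0 \<longrightarrow> snd q \<subseteq> W)) \<and> snd q \<subseteq> fst p"
      using nbhd[of "fst p"] openB by auto
  qed
  then obtain f where "\<forall>n. (?P (f n) \<and> (n = (0::nat) \<longrightarrow> snd (f n) \<subseteq> W)) \<and> snd (f (Suc n)) \<subseteq> fst (f n)"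
    by blast
  then have f: "\<And>n. fst (f n) \<in> \<B>" "\<And>n. closedin X (snd (f n))" "\<And>n. x \<in> fst (f n)"
    "\<And>n. fst (f n) \<subseteq> snd (f n)" "snd (f 0) \<subseteq> W" "\<And>n. snd (f (Suc n)) \<subseteq> fst (f n)"
    by (auto simp: case_prod_beta)
  \<comment> \<open>The two sequences interleave, so they have the same intersection. One form uses
    countably many base elements, the other is closed.\<close>
  have eq: "topspace X \<inter> (\<Inter>n. fst (f n)) = (\<Inter>n. snd (f n))"
    using f(4,6) closedin_subset[OF f(2)] by (auto, blast+)
  have "closedin X (\<Inter>n. snd (f n))"
    using f(2) by (intro closedin_Inter) auto
  then show ?thesis
    using f eq by (intro that[of "range (\<lambda>n. fst (f n))"]) auto
qed

text \<open>This codes small subfamilies of \<open>\<B>\<close>, so that the size of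
  \<open>short_sequences\<close> bounds their number. A family of size below \<kappa> is indexed by
  a proper initial segment, and \<open>s\<close> lists codes of its members along it.\<close>

lemma ordLess_short_sequence:
  assumes card: "Card_order \<kappa>" and "S \<subseteq> \<B>" "|S| <o \<kappa>"
    and e: "\<B> \<subseteq> e ` Field \<kappa>"
  obtains s where "s \<in> short_sequences \<kappa>" "S = e ` ran s"
proof -
  have wo: "Well_order \<kappa>"
    using card by (rule card_order_on_well_order_on)
  obtain a where a: "a \<in> Field \<kappa>" "|S| =o Restr \<kappa> (underS \<kappa> a)"
    using assms(3) ordLess_iff_ordIso_Restr[OF wo card_of_Well_order] by blast
  have "Field (Restr \<kappa> (underS \<kappa> a)) = underS \<kappa> a"
    using wo by (simp add: Field_Restr_ofilter wo_rel_def wo_rel.underS_ofilter)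
  then obtain f where f: "bij_betw f S (underS \<kappa> a)"
    using a(2) by (auto simp: ordIso_def iso_def Field_card_of)
  let ?i = "inv_into (Field \<kappa>) e"
  define s where "s = (\<lambda>b. if b \<in> underS \<kappa> a then Some (?i (inv_into S f b)) else None)"
  have inS: "inv_into S f b \<in> S" if "b \<in> underS \<kappa> a" for b
    using bij_betw_inv_into[OF f] that by (auto simp: bij_betw_def)
  have ran: "ran s = (\<lambda>b. ?i (inv_into S f b)) ` underS \<kappa> a"
    by (auto simp: s_def ran_def)
  have i: "?i B \<in> Field \<kappa>" "e (?i B) = B" if "B \<in> S" for B
    using that e assms(2) by (auto intro: inv_into_into f_inv_into_f)
  have "dom s = underS \<kappa> a"
    by (auto simp: s_def split: if_splits)
  then have "s \<in> short_sequences \<kappa>"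
    unfolding short_sequences_def using a(1) i(1) inS ran by auto
  moreover have "e ` ran s = (\<lambda>b. inv_into S f b) ` underS \<kappa> a"
    unfolding ran image_image using i(2) inS by (auto intro!: image_cong)
  then have "S = e ` ran s"
    using bij_betw_inv_into[OF f] by (simp add: bij_betw_def)
  ultimately show ?thesis by (rule that)
qed

text \<open>Each of the fewer than \<kappa> open sets defining \<open>G\<close> is replaced by
  countably many base elements with closed intersection around the point. As \<kappa> is uncountable
  and regular, fewer than \<kappa> base elements are used in all, and such intersections are counted
  by short sequences.\<close>

lemma closed_short_base:
  fixes \<kappa> :: "'k rel" and X :: "'a topology"
  assumes card: "Cinfinite \<kappa>" and unc: "natLeq <o \<kappa>" and regc: "regularCard \<kappa>"
    and seq: "|short_sequences \<kappa>| =o \<kappa>"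
    and reg: "regular_space X" and weight: "weight_le X \<kappa>"
  obtains c :: "'k \<Rightarrow> 'a set" where
    "\<And>\<xi>. short_Inter_open \<kappa> X (c \<xi>)" "\<And>\<xi>. closedin X (c \<xi>)"
    "\<And>G x. short_Inter_open \<kappa> X G \<Longrightarrow> x \<in> G \<Longrightarrow> \<exists>\<xi>\<in>Field \<kappa>. x \<in> c \<xi> \<and> c \<xi> \<subseteq> G"
proof -
  have co: "Card_order \<kappa>" using card by simp
  have enum: "\<exists>e :: 'k \<Rightarrow> 'b set. A \<subseteq> e ` Field \<kappa> \<and> range e \<subseteq> insert {} A" if "|A| \<le>o \<kappa>" for A :: "'b set set"
  proof -
    have "|A| \<le>o |Field \<kappa>|"
      using that card_of_Field_ordIso[OF co] ordIso_symmetric ordLeq_ordIso_trans by blast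
    then obtain f where f: "inj_on f A" "f ` A \<subseteq> Field \<kappa>"
      using card_of_ordLeq[of A "Field \<kappa>"] by blast
    \<comment> \<open>The default value is the empty set, which is closed and open, so the
      enumeration of the new base can be total on the type.\<close>
    define e where "e \<xi> = (if \<xi> \<in> f ` A then inv_into A f \<xi> else {})" for \<xi>
    have "e (f a) = a" if "a \<in> A" for a using that f(1) by (simp add: e_def)
    then have "A \<subseteq> e ` Field \<kappa>" using f(2) by (metis image_eqI image_subset_iff subsetI)
    moreover have "range e \<subseteq> insert {} A" by (auto simp: e_def inv_into_into)
    ultimately show ?thesis by blast
  qed
  obtain \<B> where \<B>: "base_of X \<B>" "|\<B>| \<le>o \<kappa>"
    using weight unfolding weight_le_def by blast
  note openB = openin_base_of[OF \<B>(1)]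
  obtain e :: "'k \<Rightarrow> 'a set" where e: "\<B> \<subseteq> e ` Field \<kappa>"
    using enum[OF \<B>(2)] by blast
  let ?I = "\<lambda>s. topspace X \<inter> \<Inter>(e ` ran s)"
  \<comment> \<open>Not every code yields a closed set; keeping those that do can only lower the
    count.\<close>
  define \<C> where "\<C> = {C \<in> ?I ` short_sequences \<kappa>. closedin X C \<and> short_Inter_open \<kappa> X C}"
  have "|\<C>| \<le>o |?I ` short_sequences \<kappa>|"
    unfolding \<C>_def by (rule card_of_mono1) auto
  also have "|?I ` short_sequences \<kappa>| \<le>o |short_sequences \<kappa>|"
    by (rule card_of_image)
  also note seq
  finally have "|\<C>| \<le>o \<kappa>" .
  then obtain c :: "'k \<Rightarrow> 'a set" where c: "\<C> \<subseteq> c ` Field \<kappa>" "range c \<subseteq> insert {} \<C>"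
    using enum by metis
  have "closedin X (c \<xi>) \<and> short_Inter_open \<kappa> X (c \<xi>)" for \<xi>
  proof -
    have "c \<xi> = {} \<or> c \<xi> \<in> \<C>" using c(2) by blast
    then show ?thesis
      using openin_short_Inter_open[OF card openin_empty, of X] by (auto simp: \<C>_def)
  qed
  moreover have "\<exists>\<xi>\<in>Field \<kappa>. x \<in> c \<xi> \<and> c \<xi> \<subseteq> G" if G: "short_Inter_open \<kappa> X G" "x \<in> G" for G x
  proof -
    obtain \<O> where \<O>: "|\<O>| <o \<kappa>" "\<And>W. W \<in> \<O> \<Longrightarrow> openin X W" "G = topspace X \<inter> \<Inter>\<O>"
      using G(1) unfolding short_Inter_open_def by blast
    have "\<exists>\<S>. countable \<S> \<and> \<S> \<subseteq> \<B> \<and> x \<in> \<Inter>\<S> \<and> closedin X (topspace X \<inter> \<Inter>\<S>) \<and> topspace X \<inter> \<Inter>\<S> \<subseteq> W"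
      if "W \<in> \<O>" for W
    proof -
      have "x \<in> W" using G(2) \<O>(3) that by blast
      from regular_space_closed_Inter[OF reg \<B>(1) \<O>(2)[OF that] this] show ?thesis by metis
    qed
    then obtain \<S> where \<S>: "\<And>W. W \<in> \<O> \<Longrightarrow> countable (\<S> W) \<and> \<S> W \<subseteq> \<B> \<and> x \<in> \<Inter>(\<S> W) \<and>
        closedin X (topspace X \<inter> \<Inter>(\<S> W)) \<and> topspace X \<inter> \<Inter>(\<S> W) \<subseteq> W"
      by metis
    let ?S = "\<Union>W\<in>\<O>. \<S> W"
    have "|\<S> W| <o \<kappa>" if "W \<in> \<O>" for W
    proof -
      have "|\<S> W| \<le>o |UNIV :: nat set|"
        using \<S>[OF that] unfolding countable_def card_of_ordLeq[symmetric] by blast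
      then show ?thesis
        using unc card_of_nat ordLeq_ordIso_trans ordLeq_ordLess_trans by blast
    qed
    then have less: "|?S| <o \<kappa>"
      using card_of_UNION_ordLess_infinite_Field_regularCard[OF regc card \<O>(1)] by blast
    have sub: "?S \<subseteq> \<B>" using \<S> by blast
    obtain s where s: "s \<in> short_sequences \<kappa>" "?S = e ` ran s"
      using ordLess_short_sequence[OF co sub less e] by blast
    \<comment> \<open>Inserting \<open>topspace X\<close> keeps the family of closed sets nonempty
      even if \<open>\<O>\<close> is empty.\<close>
    have eq: "topspace X \<inter> \<Inter>?S = \<Inter>(insert (topspace X) ((\<lambda>W. topspace X \<inter> \<Inter>(\<S> W)) ` \<O>))"
      by auto
    have "closedin X (topspace X \<inter> \<Inter>?S)"
      unfolding eq using \<S> by (intro closedin_Inter) auto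
    moreover have "short_Inter_open \<kappa> X (topspace X \<inter> \<Inter>?S)"
      unfolding short_Inter_open_def using less sub openB by blast
    ultimately have "topspace X \<inter> \<Inter>?S \<in> \<C>"
      unfolding \<C>_def using s by auto
    then have "topspace X \<inter> \<Inter>?S \<in> c ` Field \<kappa>"
      by (rule subsetD[OF c(1)])
    then obtain \<xi> where "\<xi> \<in> Field \<kappa>" "topspace X \<inter> \<Inter>?S = c \<xi>"
      by (rule imageE)
    moreover have "x \<in> topspace X \<inter> \<Inter>?S"
      using G(2) \<S> unfolding \<O>(3) by auto
    moreover have "topspace X \<inter> \<Inter>?S \<subseteq> G"
      unfolding \<O>(3) using \<S> by fastforce
    ultimately show ?thesis by (intro bexI[of _ \<xi>]) simp_all
  qed
  ultimately show ?thesis by (intro that) blast+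
qed

section \<open>Order facts and the refined topology\<close>

text \<open>The weight bound, the regularity of the space and the count of short sequences are
  condensed into \<open>c\<close>. Its members are closed, so their complements are open too and a
  cell can be cut along each of them.\<close>

locale choquet_base =
  fixes \<kappa> :: "'k rel" and X :: "'a topology" and c :: "'k \<Rightarrow> 'a set" and \<sigma> :: "('k, 'a) strategy"
  assumes cinf: "Cinfinite \<kappa>" and regular: "regularCard \<kappa>"
    and c_open: "\<And>\<xi>. short_Inter_open \<kappa> X (c \<xi>)" and c_closed: "\<And>\<xi>. closedin X (c \<xi>)"
    and c_base: "\<And>G x. short_Inter_open \<kappa> X G \<Longrightarrow> x \<in> G \<Longrightarrow> \<exists>\<xi>\<in>Field \<kappa>. x \<in> c \<xi> \<and> c \<xi> \<subseteq> G"
    and winning: "winning_strategy \<kappa> X \<sigma>"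
begin

lemma Card_order: "Card_order \<kappa>"
  using cinf by simp

lemma Well_order: "Well_order \<kappa>"
  using Card_order by (rule card_order_on_well_order_on)

lemma wo_rel: "wo_rel \<kappa>"
  using Well_order by (simp add: wo_rel_def)

lemma kappa_trans: "(\<alpha>, \<beta>) \<in> \<kappa> \<Longrightarrow> (\<beta>, \<gamma>) \<in> \<kappa> \<Longrightarrow> (\<alpha>, \<gamma>) \<in> \<kappa>"
  using wo_rel.TRANS[OF wo_rel] by (rule transD)

lemma kappa_antisym: "(\<alpha>, \<beta>) \<in> \<kappa> \<Longrightarrow> (\<beta>, \<alpha>) \<in> \<kappa> \<Longrightarrow> \<alpha> = \<beta>"
  using wo_rel.ANTISYM[OF wo_rel] by (rule antisymD)

lemma wf_strict: "wf (\<kappa> - Id)"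
  using Well_order by (simp add: well_order_on_def)

lemma in_under: "\<alpha> \<in> Field \<kappa> \<Longrightarrow> \<alpha> \<in> under \<kappa> \<alpha>"
  using wo_rel.REFL[OF wo_rel] by (simp add: under_def refl_on_def)

lemma underS_subset_under: "\<beta> \<in> underS \<kappa> \<alpha> \<Longrightarrow> \<beta> \<in> under \<kappa> \<alpha>"
  by (auto simp: underS_def under_def)

lemma under_cases: "\<beta> \<in> under \<kappa> \<alpha> \<Longrightarrow> \<beta> = \<alpha> \<or> \<beta> \<in> underS \<kappa> \<alpha>"
  by (auto simp: underS_def under_def)

lemma under_subset_underS: "\<beta> \<in> underS \<kappa> \<alpha> \<Longrightarrow> \<gamma> \<in> under \<kappa> \<beta> \<Longrightarrow> \<gamma> \<in> underS \<kappa> \<alpha>"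
  by (auto simp: underS_def under_def dest: kappa_trans kappa_antisym)

lemma underS_Field: "\<beta> \<in> underS \<kappa> \<alpha> \<Longrightarrow> \<beta> \<in> Field \<kappa>"
  by (auto simp: underS_def Field_def)

lemma under_Field: "\<beta> \<in> under \<kappa> \<alpha> \<Longrightarrow> \<beta> \<in> Field \<kappa>"
  by (auto simp: under_def Field_def)

lemma under_or_underS: "\<alpha> \<in> Field \<kappa> \<Longrightarrow> \<beta> \<in> Field \<kappa> \<Longrightarrow> \<beta> \<in> under \<kappa> \<alpha> \<or> \<alpha> \<in> underS \<kappa> \<beta>"
  using wo_rel.TOTALS[OF wo_rel] by (auto simp: under_def underS_def)

lemma card_underS: "\<alpha> \<in> Field \<kappa> \<Longrightarrow> |underS \<kappa> \<alpha>| <o \<kappa>"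
  by (rule card_of_underS[OF Card_order])

text \<open>The open sets of the topology generated by the intersections of fewer than \<open>\<kappa>\<close> open sets.\<close>

definition kopen :: "'a set \<Rightarrow> bool" where
  "kopen S \<longleftrightarrow> (\<forall>x\<in>S. \<exists>G. short_Inter_open \<kappa> X G \<and> x \<in> G \<and> G \<subseteq> S)"

lemma kopen_short: "short_Inter_open \<kappa> X G \<Longrightarrow> kopen G"
  unfolding kopen_def by blast

lemma kopen_base: "kopen S \<Longrightarrow> x \<in> S \<Longrightarrow> \<exists>\<xi>\<in>Field \<kappa>. x \<in> c \<xi> \<and> c \<xi> \<subseteq> S"
  unfolding kopen_def using c_base by (meson subset_trans)

lemma kopen_subset: "kopen S \<Longrightarrow> S \<subseteq> topspace X"
  unfolding kopen_def using short_Inter_open_subset by blast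

lemma kopenI: "(\<And>x. x \<in> S \<Longrightarrow> \<exists>T. kopen T \<and> x \<in> T \<and> T \<subseteq> S) \<Longrightarrow> kopen S"
  unfolding kopen_def by (meson subset_trans)

lemma kopen_Int: "kopen S \<Longrightarrow> kopen T \<Longrightarrow> kopen (S \<inter> T)"
  unfolding kopen_def using short_Inter_open_Int[OF cinf regular] by (meson Int_iff Int_mono)

text \<open>Short intersections around the point are chosen in each \<open>S i\<close> and
  intersected. This keeps the limit levels of the tree and the sets of player I open.\<close>

lemma kopen_INT:
  assumes "|I| <o \<kappa>" "\<And>i. i \<in> I \<Longrightarrow> kopen (S i)"
  shows "kopen (topspace X \<inter> (\<Inter>i\<in>I. S i))"
  unfolding kopen_def
proof
  fix x assume x: "x \<in> topspace X \<inter> (\<Inter>i\<in>I. S i)"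
  then have "\<forall>i\<in>I. \<exists>G. short_Inter_open \<kappa> X G \<and> x \<in> G \<and> G \<subseteq> S i"
    using assms(2) unfolding kopen_def by blast
  then obtain G where G: "\<And>i. i \<in> I \<Longrightarrow> short_Inter_open \<kappa> X (G i) \<and> x \<in> G i \<and> G i \<subseteq> S i"
    by metis
  then show "\<exists>G. short_Inter_open \<kappa> X G \<and> x \<in> G \<and> G \<subseteq> topspace X \<inter> (\<Inter>i\<in>I. S i)"
    using short_Inter_open_INT[OF cinf regular assms(1), of X G] x
    by (intro exI[of _ "topspace X \<inter> (\<Inter>i\<in>I. G i)"]) auto
qed

lemma kopen_c: "kopen (c \<xi>)"
  by (rule kopen_short[OF c_open])

lemma kopen_Compl_c: "kopen (topspace X - c \<xi>)"
  by (rule kopen_short[OF openin_short_Inter_open[OF cinf]]) (use c_closed in blast)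

section \<open>Histories and their extension by one round\<close>

abbreviation (input) pts :: "('k \<Rightarrow> 'a \<times> 'a set \<times> 'a set) \<Rightarrow> 'k \<Rightarrow> 'a" where
  "pts h \<equiv> \<lambda>\<beta>. fst (h \<beta>)"

abbreviation (input) Us :: "('k \<Rightarrow> 'a \<times> 'a set \<times> 'a set) \<Rightarrow> 'k \<Rightarrow> 'a set" where
  "Us h \<equiv> \<lambda>\<beta>. fst (snd (h \<beta>))"

abbreviation (input) Vs :: "('k \<Rightarrow> 'a \<times> 'a set \<times> 'a set) \<Rightarrow> 'k \<Rightarrow> 'a set" where
  "Vs h \<equiv> \<lambda>\<beta>. snd (snd (h \<beta>))"

text \<open>A history stores each round as one triple, so sharing the moves of a round is a single
  equation. Values after \<alpha> have no influence, by \<open>played_cong\<close>.\<close>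

definition played :: "('k \<Rightarrow> 'a \<times> 'a set \<times> 'a set) \<Rightarrow> 'k \<Rightarrow> bool" where
  "played h \<alpha> \<longleftrightarrow> legal_I \<kappa> X (pts h) (Us h) (Vs h) \<alpha> \<and> follows \<kappa> \<sigma> (pts h) (Us h) (Vs h) \<alpha>"

lemma played_cong:
  assumes "\<alpha> \<in> Field \<kappa>" "\<And>\<beta>. \<beta> \<in> under \<kappa> \<alpha> \<Longrightarrow> h \<beta> = h' \<beta>"
  shows "played h \<alpha> = played h' \<alpha>"
  unfolding played_def
  using assms by (intro arg_cong2[of _ _ _ _ "(\<and>)"] legal_I_cong follows_cong in_under) auto

text \<open>The hypothesis on \<open>\<sigma>\<close> in terms of histories. The first part, on
  segments \<open>under \<kappa> \<alpha>\<close>, makes the next answer legal; the second is for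
  whole branches.\<close>

lemma winning_played:
  assumes "ofilter \<kappa> \<delta>" "\<And>\<alpha>. \<alpha> \<in> \<delta> \<Longrightarrow> played h \<alpha>"
  shows "\<alpha> \<in> \<delta> \<Longrightarrow> legal_II \<kappa> X (pts h) (Us h) (Vs h) \<alpha>"
    and "limit_segment \<kappa> \<delta> \<Longrightarrow> (\<Inter>\<alpha>\<in>\<delta>. Us h \<alpha>) \<noteq> {}"
proof -
  have "(\<forall>\<alpha>\<in>\<delta>. legal_II \<kappa> X (pts h) (Us h) (Vs h) \<alpha>) \<and>
      (\<forall>\<gamma>\<subseteq>\<delta>. limit_segment \<kappa> \<gamma> \<longrightarrow> (\<Inter>\<alpha>\<in>\<gamma>. Us h \<alpha>) \<noteq> {})"
    using winning[unfolded winning_strategy_def, rule_format, of \<delta> "pts h" "Us h" "Vs h"] assms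
    unfolding played_def by blast
  then show "\<alpha> \<in> \<delta> \<Longrightarrow> legal_II \<kappa> X (pts h) (Us h) (Vs h) \<alpha>"
    and "limit_segment \<kappa> \<delta> \<Longrightarrow> (\<Inter>\<alpha>\<in>\<delta>. Us h \<alpha>) \<noteq> {}" by blast+
qed

text \<open>\<open>A\<close> is the cell to be subdivided. The last clause makes round \<alpha>
  decide membership in \<open>c \<alpha>\<close>, which over all rounds turns the cells into a
  base.\<close>

definition good :: "'k \<Rightarrow> 'a set \<Rightarrow> ('k \<Rightarrow> 'a \<times> 'a set \<times> 'a set) \<Rightarrow> bool" where
  "good \<alpha> A h \<longleftrightarrow> played h \<alpha> \<and> Vs h \<alpha> \<subseteq> Us h \<alpha> \<and> Us h \<alpha> \<subseteq> A \<and>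
     (Us h \<alpha> \<subseteq> c \<alpha> \<or> Us h \<alpha> \<inter> c \<alpha> = {})"

lemma good_cong:
  assumes "\<alpha> \<in> Field \<kappa>" "\<And>\<beta>. \<beta> \<in> under \<kappa> \<alpha> \<Longrightarrow> h \<beta> = h' \<beta>"
  shows "good \<alpha> A h = good \<alpha> A h'"
  unfolding good_def using played_cong[OF assms] assms(2)[OF in_under[OF assms(1)]] by simp

text \<open>The fibres of \<open>m\<close> are the next cells inside \<open>A\<close>, each sharing
  one move. The point played in \<open>m x\<close> need not be \<open>x\<close>; only the answer has
  to contain \<open>x\<close>.\<close>

definition step :: "'k \<Rightarrow> 'a set \<Rightarrow> ('k \<Rightarrow> 'a \<times> 'a set \<times> 'a set) \<Rightarrow> ('a \<Rightarrow> 'a \<times> 'a set \<times> 'a set) \<Rightarrow> bool"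
  where "step \<alpha> A h m \<longleftrightarrow>
    (\<forall>x\<in>A. good \<alpha> A (h(\<alpha> := m x)) \<and> x \<in> snd (snd (m x)) \<and> kopen {y \<in> A. m y = m x})"

text \<open>Player I plays \<open>x\<close> with a basic set inside \<open>A\<close> and on one side
  of \<open>c \<alpha>\<close>. The answer of the winning strategy is legal, so it contains a basic
  neighbourhood of \<open>x\<close>.\<close>

lemma good_move_exists:
  assumes \<alpha>: "\<alpha> \<in> Field \<kappa>" and "kopen A" and h: "\<And>\<beta>. \<beta> \<in> underS \<kappa> \<alpha> \<Longrightarrow> played h \<beta>"
    and sub: "\<And>\<beta>. \<beta> \<in> underS \<kappa> \<alpha> \<Longrightarrow> A \<subseteq> Vs h \<beta>" and x: "x \<in> A"
  obtains t \<eta> where "\<eta> \<in> Field \<kappa>" "good \<alpha> A (h(\<alpha> := t))" "x \<in> c \<eta>" "c \<eta> \<subseteq> snd (snd t)"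
proof -
  define D where "D = (if x \<in> c \<alpha> then c \<alpha> else topspace X - c \<alpha>)"
  have "kopen D" "x \<in> D"
    using kopen_c kopen_Compl_c x kopen_subset[OF \<open>kopen A\<close>] by (auto simp: D_def)
  then obtain \<xi> where \<xi>: "x \<in> c \<xi>" "c \<xi> \<subseteq> A \<inter> D"
    using kopen_base[OF kopen_Int[OF \<open>kopen A\<close>]] x by blast
  \<comment> \<open>The strategy sees the answers of II before round \<alpha> only, so
    \<open>v\<close> is defined without circularity.\<close>
  define v where "v = \<sigma> \<alpha> (restrict ((pts h)(\<alpha> := x)) (under \<kappa> \<alpha>))
    (restrict ((Us h)(\<alpha> := c \<xi>)) (under \<kappa> \<alpha>)) (restrict (Vs h) (underS \<kappa> \<alpha>))"
  define h' where "h' = h(\<alpha> := (x, c \<xi>, v))"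
  have h'\<alpha>: "h' \<alpha> = (x, c \<xi>, v)" by (simp add: h'_def)
  have h'\<beta>: "h' \<beta> = h \<beta>" if "\<beta> \<in> underS \<kappa> \<alpha>" for \<beta>
    using that by (auto simp: h'_def underS_def)
  have eq: "pts h' = (pts h)(\<alpha> := x)" "Us h' = (Us h)(\<alpha> := c \<xi>)"
    "restrict (Vs h') (underS \<kappa> \<alpha>) = restrict (Vs h) (underS \<kappa> \<alpha>)"
    using h'\<beta> by (auto simp: h'_def fun_eq_iff restrict_def)
  have "follows \<kappa> \<sigma> (pts h') (Us h') (Vs h') \<alpha>"
    unfolding follows_def eq by (simp add: h'\<alpha> v_def)
  moreover have "legal_I \<kappa> X (pts h') (Us h') (Vs h') \<alpha>"
  proof -
    \<comment> \<open>All earlier answers contain \<open>A\<close>, so the restriction imposed on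
      player I costs nothing.\<close>
    have "c \<xi> = c \<xi> \<inter> (\<Inter>\<beta>\<in>underS \<kappa> \<alpha>. Vs h' \<beta>)"
      using sub \<xi>(2) h'\<beta> by fastforce
    then show ?thesis
      unfolding legal_I_def using \<xi>(1) c_open by (auto simp: h'\<alpha>)
  qed
  ultimately have "played h' \<alpha>" by (simp add: played_def)
  moreover have "played h' \<beta>" if "\<beta> \<in> underS \<kappa> \<alpha>" for \<beta>
    using played_cong[of \<beta> h' h] h[OF that] underS_Field[OF that] h'\<beta> under_subset_underS[OF that] by blast
  ultimately have "legal_II \<kappa> X (pts h') (Us h') (Vs h') \<alpha>"
    using winning_played(1)[OF wo_rel.under_ofilter[OF wo_rel], of \<alpha> h' \<alpha>] in_under[OF \<alpha>] under_cases by blast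
  then obtain G where G: "short_Inter_open \<kappa> X G" "v = G \<inter> c \<xi>" "x \<in> v"
    unfolding legal_II_def h'\<alpha> by auto
  then obtain \<eta> where "\<eta> \<in> Field \<kappa>" "x \<in> c \<eta>" "c \<eta> \<subseteq> v"
    using kopen_base[OF kopen_Int[OF kopen_short[OF G(1)] kopen_c]] by blast
  moreover have "good \<alpha> A h'"
    unfolding good_def h'\<alpha> using \<open>played h' \<alpha>\<close> \<xi> G(2) by (auto simp: D_def split: if_splits)
  ultimately show ?thesis
    using that[of \<eta> "(x, c \<xi>, v)"] by (simp add: h'_def)
qed

text \<open>
  The answers of the strategy to the good moves of I cover \<open>A\<close>. They are made disjoint by choosing
  for each point the first basic set contained in one of them; the pieces are still open because
  fewer than \<open>\<kappa>\<close> closed basic sets are removed.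
\<close>

lemma step_exists:
  assumes \<alpha>: "\<alpha> \<in> Field \<kappa>" and "kopen A" and h: "\<And>\<beta>. \<beta> \<in> underS \<kappa> \<alpha> \<Longrightarrow> played h \<beta>"
    and sub: "\<And>\<beta>. \<beta> \<in> underS \<kappa> \<alpha> \<Longrightarrow> A \<subseteq> Vs h \<beta>"
  shows "\<exists>m. step \<alpha> A h m"
proof -
  define P where "P \<eta> t \<longleftrightarrow> good \<alpha> A (h(\<alpha> := t)) \<and> c \<eta> \<subseteq> snd (snd t)" for \<eta> t
  define K where "K = {\<eta> \<in> Field \<kappa>. \<exists>t. P \<eta> t}"
  have "\<exists>\<eta>\<in>K. x \<in> c \<eta> \<and> (\<forall>\<zeta>\<in>K \<inter> underS \<kappa> \<eta>. x \<notin> c \<zeta>)" if "x \<in> A" for x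
  proof -
    obtain \<eta> where "\<eta> \<in> {\<eta> \<in> K. x \<in> c \<eta>}"
    proof (rule good_move_exists[OF \<alpha> \<open>kopen A\<close> h sub \<open>x \<in> A\<close>])
      fix t \<eta> assume "\<eta> \<in> Field \<kappa>" "good \<alpha> A (h(\<alpha> := t))" "x \<in> c \<eta>" "c \<eta> \<subseteq> snd (snd t)"
      then have "\<eta> \<in> {\<eta> \<in> K. x \<in> c \<eta>}" unfolding K_def P_def by blast
      then show thesis by (rule that)
    qed
    from wfE_min[OF wf_strict this] obtain \<zeta> where
      "\<zeta> \<in> {\<eta> \<in> K. x \<in> c \<eta>}" "\<And>\<eta>. (\<eta>, \<zeta>) \<in> \<kappa> - Id \<Longrightarrow> \<eta> \<notin> {\<eta> \<in> K. x \<in> c \<eta>}"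
      by blast
    then show ?thesis unfolding underS_def by blast
  qed
  then obtain f where f: "\<And>x. x \<in> A \<Longrightarrow> f x \<in> K \<and> x \<in> c (f x) \<and> (\<forall>\<zeta>\<in>K \<inter> underS \<kappa> (f x). x \<notin> c \<zeta>)"
    by metis
  \<comment> \<open>\<open>m x\<close> depends on \<open>x\<close> only through the index
    \<open>f x\<close>, so points with the same first index receive the same move.\<close>
  define m where "m x = (SOME t. P (f x) t)" for x
  have m: "P (f x) (m x)" if "x \<in> A" for x
    using f[OF that] someI_ex[of "P (f x)"] unfolding K_def m_def by blast
  have "kopen {y \<in> A. m y = m x}" for x
  proof (rule kopenI)
    fix y assume y: "y \<in> {y \<in> A. m y = m x}"
    let ?\<eta> = "f y"
    let ?N = "topspace X \<inter> (\<Inter>\<zeta>\<in>K \<inter> underS \<kappa> ?\<eta>. topspace X - c \<zeta>)"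
    let ?T = "A \<inter> (c ?\<eta> \<inter> ?N)"
    have "?\<eta> \<in> Field \<kappa>" using f y by (auto simp: K_def)
    then have "|K \<inter> underS \<kappa> ?\<eta>| <o \<kappa>"
      using card_underS card_of_mono1[of "K \<inter> underS \<kappa> ?\<eta>" "underS \<kappa> ?\<eta>"] ordLeq_ordLess_trans by blast
    then have "kopen ?T"
      using \<open>kopen A\<close> by (intro kopen_Int kopen_c kopen_INT kopen_Compl_c)
    moreover have "y \<in> ?T"
      using f y kopen_subset[OF \<open>kopen A\<close>] by auto
    moreover have "?T \<subseteq> {y \<in> A. m y = m x}"
    proof
      fix z assume z: "z \<in> ?T"
      then have "z \<in> A" "y \<in> A" using y by auto
      note fz = f[OF this(1)] and fy = f[OF this(2)]
      \<comment> \<open>\<open>z\<close> avoids the earlier basic sets indexed by \<open>K\<close>,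
        which excludes a smaller index; it lies in the basic set of \<open>y\<close>, which excludes
        a larger one.\<close>
      have "f z \<notin> underS \<kappa> ?\<eta>" "?\<eta> \<notin> underS \<kappa> (f z)"
        using fz fy z by blast+
      then have "f z = ?\<eta>"
        using fz fy under_or_underS[of "?\<eta>" "f z"] under_cases unfolding K_def by blast
      then have "m z = m y" by (simp only: m_def)
      then show "z \<in> {y \<in> A. m y = m x}" using y \<open>z \<in> A\<close> by simp
    qed
    ultimately show "\<exists>T. kopen T \<and> y \<in> T \<and> T \<subseteq> {y \<in> A. m y = m x}"
      by (intro exI[of _ ?T] conjI)
  qed
  then have "step \<alpha> A h m"
    unfolding step_def using m f unfolding P_def by blast
  then show ?thesis by blast
qed

section \<open>The tree of partitions\<close>

text \<open>
  The sequence of moves assigned to each point. Agreement before round \<open>\<alpha>\<close> is an equivalence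
  relation whose classes are the level \<open>\<alpha>\<close> of a tree of partitions.
\<close>

definition plays_rec :: "('k \<Rightarrow> 'a \<Rightarrow> 'a \<times> 'a set \<times> 'a set) \<Rightarrow> 'k \<Rightarrow> 'a \<Rightarrow> 'a \<times> 'a set \<times> 'a set" where
  "plays_rec f \<alpha> x = (SOME m. step \<alpha> {y \<in> topspace X. \<forall>\<beta>\<in>underS \<kappa> \<alpha>. f \<beta> y = f \<beta> x}
     (restrict (\<lambda>\<beta>. f \<beta> x) (underS \<kappa> \<alpha>)) m) x"

definition plays :: "'k \<Rightarrow> 'a \<Rightarrow> 'a \<times> 'a set \<times> 'a set" where
  "plays = wfrec (\<kappa> - Id) plays_rec"

definition cellS :: "'k \<Rightarrow> 'a \<Rightarrow> 'a set" where
  "cellS \<alpha> x = {y \<in> topspace X. \<forall>\<beta>\<in>underS \<kappa> \<alpha>. plays \<beta> y = plays \<beta> x}"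

text \<open>\<open>cellS \<alpha>\<close> is the level before round \<alpha> and
  \<open>cell \<alpha>\<close> the level after it, in analogy with \<open>underS\<close> and
  \<open>under\<close>.\<close>

definition cell :: "'k \<Rightarrow> 'a \<Rightarrow> 'a set" where
  "cell \<alpha> x = {y \<in> topspace X. \<forall>\<beta>\<in>under \<kappa> \<alpha>. plays \<beta> y = plays \<beta> x}"

text \<open>The chosen \<open>m\<close> depends on the point only through its cell and the history
  common to that cell. Thus all points of a cell use the same subdivision.\<close>

lemma plays_unfold:
  "plays \<alpha> x = (SOME m. step \<alpha> (cellS \<alpha> x) (restrict (\<lambda>\<beta>. plays \<beta> x) (underS \<kappa> \<alpha>)) m) x"
proof -
  have cut: "cut plays (\<kappa> - Id) \<alpha> \<beta> = plays \<beta>" if "\<beta> \<in> underS \<kappa> \<alpha>" for \<beta>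
    using that by (auto simp: cut_def underS_def)
  have "plays \<alpha> = plays_rec (cut plays (\<kappa> - Id) \<alpha>) \<alpha>"
    unfolding plays_def by (rule wfrec[OF wf_strict])
  \<comment> \<open>Round \<alpha> of the recursion consults earlier rounds only, where the cut
    changes nothing.\<close>
  also have "\<dots> = plays_rec plays \<alpha>"
  proof
    fix x
    have "restrict (\<lambda>\<beta>. cut plays (\<kappa> - Id) \<alpha> \<beta> x) (underS \<kappa> \<alpha>) = restrict (\<lambda>\<beta>. plays \<beta> x) (underS \<kappa> \<alpha>)"
      using cut by (auto intro!: restrict_ext)
    then show "plays_rec (cut plays (\<kappa> - Id) \<alpha>) \<alpha> x = plays_rec plays \<alpha> x"
      using cut unfolding plays_rec_def by simp
  qed
  finally show ?thesis
    unfolding plays_rec_def cellS_def by simp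
qed

text \<open>For \<alpha> in the field this involves fewer than \<kappa> cells, in the form that
  \<open>kopen_INT\<close> needs. The factor \<open>topspace X\<close> is the root of the
  tree.\<close>

lemma cellS_eq: "cellS \<alpha> x = topspace X \<inter> (\<Inter>\<beta>\<in>underS \<kappa> \<alpha>. cell \<beta> x)"
proof (intro equalityI subsetI)
  fix y assume "y \<in> cellS \<alpha> x"
  then show "y \<in> topspace X \<inter> (\<Inter>\<beta>\<in>underS \<kappa> \<alpha>. cell \<beta> x)"
    by (auto simp: cellS_def cell_def dest: under_subset_underS)
next
  fix y assume "y \<in> topspace X \<inter> (\<Inter>\<beta>\<in>underS \<kappa> \<alpha>. cell \<beta> x)"
  then show "y \<in> cellS \<alpha> x"
    using in_under[OF underS_Field] by (auto simp: cellS_def cell_def)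
qed

lemma cell_eq: "\<alpha> \<in> Field \<kappa> \<Longrightarrow> cell \<alpha> x = {y \<in> cellS \<alpha> x. plays \<alpha> y = plays \<alpha> x}"
  using in_under underS_subset_under under_cases by (fastforce simp: cell_def cellS_def)

text \<open>The three claims need a joint induction: open earlier cells make the current one open,
  earlier good moves give a play around it, and so the choice in the recursion succeeds.\<close>

lemma plays_good:
  assumes "\<alpha> \<in> Field \<kappa>" "x \<in> topspace X"
  shows "good \<alpha> (cellS \<alpha> x) (\<lambda>\<beta>. plays \<beta> x) \<and> x \<in> snd (snd (plays \<alpha> x)) \<and> kopen (cell \<alpha> x)"
  using wf_strict assms
proof (induction \<alpha> arbitrary: x rule: wf_induct_rule)
  case (less \<alpha>)
  have IH: "good \<beta> (cellS \<beta> y) (\<lambda>\<beta>. plays \<beta> y)" "y \<in> snd (snd (plays \<beta> y))" "kopen (cell \<beta> y)"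
    if "\<beta> \<in> underS \<kappa> \<alpha>" "y \<in> topspace X" for \<beta> y
    using less.IH[of \<beta> y] that underS_Field[OF that(1)] by (auto simp: underS_def)
  let ?A = "cellS \<alpha> x"
  let ?h = "restrict (\<lambda>\<beta>. plays \<beta> x) (underS \<kappa> \<alpha>)"
  have "kopen ?A"
    unfolding cellS_eq using IH(3) less.prems by (intro kopen_INT card_underS)
  moreover have "played ?h \<beta>" if "\<beta> \<in> underS \<kappa> \<alpha>" for \<beta>
    using IH(1)[OF that less.prems(2)] under_subset_underS[OF that] underS_Field[OF that]
      played_cong[of \<beta> ?h "\<lambda>\<beta>. plays \<beta> x"] by (simp add: good_def)
  \<comment> \<open>A point of the cell lies in its own answer of round \<beta>, which it shares
    with \<open>x\<close>.\<close>
  moreover have "?A \<subseteq> Vs ?h \<beta>" if "\<beta> \<in> underS \<kappa> \<alpha>" for \<beta>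
  proof
    fix y assume "y \<in> ?A"
    then have "y \<in> topspace X" "plays \<beta> y = plays \<beta> x" using that by (auto simp: cellS_def)
    then show "y \<in> Vs ?h \<beta>" using IH(2)[OF that, of y] that by simp
  qed
  ultimately have ex: "\<exists>m. step \<alpha> ?A ?h m"
    by (intro step_exists less.prems(1))
  define m where "m = (SOME m. step \<alpha> ?A ?h m)"
  have m: "step \<alpha> ?A ?h m"
    unfolding m_def by (rule someI_ex[OF ex])
  have m_eq: "plays \<alpha> y = m y" if y: "y \<in> ?A" for y
  proof -
    have "cellS \<alpha> y = ?A" using y by (auto simp: cellS_def)
    moreover have "restrict (\<lambda>\<beta>. plays \<beta> y) (underS \<kappa> \<alpha>) = ?h"
      using y by (auto intro!: restrict_ext simp: cellS_def)
    ultimately show ?thesis unfolding m_def by (simp add: plays_unfold[of \<alpha> y])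
  qed
  have x: "x \<in> ?A" using less.prems(2) by (simp add: cellS_def)
  have "good \<alpha> ?A (?h(\<alpha> := m x))" "x \<in> snd (snd (m x))" "kopen {y \<in> ?A. m y = m x}"
    using m x by (auto simp: step_def)
  moreover have "cell \<alpha> x = {y \<in> ?A. m y = m x}"
    unfolding cell_eq[OF less.prems(1)] using m_eq x by auto
  moreover have "good \<alpha> ?A (?h(\<alpha> := m x)) = good \<alpha> ?A (\<lambda>\<beta>. plays \<beta> x)"
    using m_eq[OF x] under_cases by (intro good_cong[OF less.prems(1)]) (auto simp: underS_def)
  ultimately show ?case using m_eq[OF x] by simp
qed

section \<open>Cells form a base, and branches have nonempty intersection\<close>

text \<open>A basic set \<open>c \<xi>\<close> around \<open>x\<close> inside \<open>S\<close> is
  decided in round \<xi>. The set of I in that round contains \<open>x\<close>, hence lies inside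
  \<open>c \<xi>\<close>, and the cell lies inside the answer to it.\<close>

lemma cell_neighbourhood:
  assumes "kopen S" "x \<in> S"
  obtains \<xi> where "\<xi> \<in> Field \<kappa>" "cell \<xi> x \<subseteq> S"
proof -
  obtain \<xi> where \<xi>: "\<xi> \<in> Field \<kappa>" "x \<in> c \<xi>" "c \<xi> \<subseteq> S"
    using kopen_base[OF assms] by blast
  have x: "x \<in> topspace X" using assms kopen_subset by blast
  note good = plays_good[OF \<xi>(1) x]
  have "y \<in> c \<xi>" if "y \<in> cell \<xi> x" for y
  proof -
    have "y \<in> topspace X" "plays \<xi> y = plays \<xi> x"
      using that in_under[OF \<xi>(1)] by (auto simp: cell_def)
    then have "y \<in> snd (snd (plays \<xi> x))"
      using plays_good[OF \<xi>(1), of y] by simp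
    then show ?thesis using good \<xi>(2) unfolding good_def by blast
  qed
  then show ?thesis using that \<xi> by blast
qed

text \<open>If \<open>D\<close> has a last round, the point belonging to it serves. Otherwise the
  histories glue to a play following \<open>\<sigma>\<close>, and winning supplies the
  point.\<close>

lemma branch_nonempty:
  assumes D: "ofilter \<kappa> D" "D \<noteq> {}" and y: "\<And>\<beta>. \<beta> \<in> D \<Longrightarrow> y \<beta> \<in> topspace X"
    and coh: "\<And>\<beta> \<gamma>. \<beta> \<in> D \<Longrightarrow> \<gamma> \<in> under \<kappa> \<beta> \<Longrightarrow> plays \<gamma> (y \<gamma>) = plays \<gamma> (y \<beta>)"
  obtains z where "z \<in> topspace X" "\<And>\<beta>. \<beta> \<in> D \<Longrightarrow> plays \<beta> z = plays \<beta> (y \<beta>)"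
proof -
  have DF: "D \<subseteq> Field \<kappa>" and down: "\<And>\<beta> \<gamma>. \<beta> \<in> D \<Longrightarrow> \<gamma> \<in> under \<kappa> \<beta> \<Longrightarrow> \<gamma> \<in> D"
    using D(1) by (auto simp: ofilter_def)
  show ?thesis
  proof (cases "limit_segment \<kappa> D")
    case False
    then obtain \<alpha> where \<alpha>: "\<alpha> \<in> D" "\<And>\<beta>. \<beta> \<in> D \<Longrightarrow> \<alpha> \<notin> underS \<kappa> \<beta>"
      using D unfolding limit_segment_def by blast
    then have "\<beta> \<in> under \<kappa> \<alpha>" if "\<beta> \<in> D" for \<beta>
      using under_or_underS[of \<alpha> \<beta>] that DF by blast
    then show ?thesis
      using coh[OF \<alpha>(1)] by (intro that[of "y \<alpha>"] y[OF \<alpha>(1)]) simp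
  next
    case True
    \<comment> \<open>By coherence this diagonal agrees up to \<beta> with the history of
      \<open>y \<beta>\<close>, so all its rounds are properly played.\<close>
    define q where "q \<beta> = plays \<beta> (y \<beta>)" for \<beta>
    have good: "good \<beta> (cellS \<beta> (y \<beta>)) q" if "\<beta> \<in> D" for \<beta>
    proof -
      have "good \<beta> (cellS \<beta> (y \<beta>)) (\<lambda>\<gamma>. plays \<gamma> (y \<beta>))"
        using plays_good that DF y by blast
      moreover have "q \<gamma> = plays \<gamma> (y \<beta>)" if "\<gamma> \<in> under \<kappa> \<beta>" for \<gamma>
        using coh[OF \<open>\<beta> \<in> D\<close> that] by (simp add: q_def)
      ultimately show ?thesis
        using good_cong[of \<beta> q "\<lambda>\<gamma>. plays \<gamma> (y \<beta>)"] subsetD[OF DF that] by simp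
    qed
    have "played q \<beta>" if "\<beta> \<in> D" for \<beta>
      using good[OF that] by (simp add: good_def)
    then obtain z where z: "\<And>\<beta>. \<beta> \<in> D \<Longrightarrow> z \<in> Us q \<beta>"
      using winning_played(2)[OF D(1) _ True, of q] by blast
    have zc: "z \<in> cellS \<beta> (y \<beta>)" if "\<beta> \<in> D" for \<beta>
      using z[OF that] good[OF that] unfolding good_def by blast
    have "plays \<beta> z = plays \<beta> (y \<beta>)" if \<beta>: "\<beta> \<in> D" for \<beta>
    proof -
      \<comment> \<open>The set of I in round \<beta> only controls the rounds before \<beta>; a
        later round of the limit segment controls \<beta> itself.\<close>
      obtain \<beta>' where \<beta>': "\<beta>' \<in> D" "\<beta> \<in> underS \<kappa> \<beta>'"
        using True \<beta> unfolding limit_segment_def by blast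
      then show ?thesis
        using zc[OF \<beta>'(1)] coh[OF \<beta>'(1) underS_subset_under[OF \<beta>'(2)]] by (simp add: cellS_def)
    qed
    moreover have "z \<in> topspace X"
      using zc D(2) by (auto simp: cellS_def)
    ultimately show ?thesis using that by blast
  qed
qed

text \<open>The levels \<open>\<xi> \<alpha>\<close> need not increase. Of two points the later lies
  in the cell of the earlier, so they agree on all rounds of the tree below both levels, and the
  histories glue to one branch.\<close>

lemma nested_cells:
  assumes "\<Gamma> \<noteq> {}" "\<Gamma> \<subseteq> Field \<kappa>" and x: "\<And>\<alpha>. \<alpha> \<in> \<Gamma> \<Longrightarrow> x \<alpha> \<in> topspace X"
    and \<xi>: "\<And>\<alpha>. \<alpha> \<in> \<Gamma> \<Longrightarrow> \<xi> \<alpha> \<in> Field \<kappa>"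
    and nest: "\<And>\<alpha> \<alpha>'. \<alpha>' \<in> \<Gamma> \<Longrightarrow> \<alpha> \<in> \<Gamma> \<Longrightarrow> \<alpha> \<in> underS \<kappa> \<alpha>' \<Longrightarrow> x \<alpha>' \<in> cell (\<xi> \<alpha>) (x \<alpha>)"
  shows "(\<Inter>\<alpha>\<in>\<Gamma>. cell (\<xi> \<alpha>) (x \<alpha>)) \<noteq> {}"
proof -
  have coh: "plays \<beta> (x \<alpha>) = plays \<beta> (x \<alpha>')"
    if "\<alpha> \<in> \<Gamma>" "\<alpha>' \<in> \<Gamma>" "\<beta> \<in> under \<kappa> (\<xi> \<alpha>)" "\<beta> \<in> under \<kappa> (\<xi> \<alpha>')" for \<alpha> \<alpha>' \<beta>
  proof -
    consider "\<alpha> = \<alpha>'" | "\<alpha> \<in> underS \<kappa> \<alpha>'" | "\<alpha>' \<in> underS \<kappa> \<alpha>"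
      using under_or_underS[of \<alpha> \<alpha>'] under_cases \<open>\<alpha> \<in> \<Gamma>\<close> \<open>\<alpha>' \<in> \<Gamma>\<close> assms(2) by blast
    then show ?thesis
      using nest[of \<alpha> \<alpha>'] nest[of \<alpha>' \<alpha>] that by cases (auto simp: cell_def)
  qed
  define D where "D = (\<Union>\<alpha>\<in>\<Gamma>. under \<kappa> (\<xi> \<alpha>))"
  have "\<forall>\<beta>\<in>D. \<exists>\<alpha>. \<alpha> \<in> \<Gamma> \<and> \<beta> \<in> under \<kappa> (\<xi> \<alpha>)" by (auto simp: D_def)
  \<comment> \<open>\<open>a \<beta>\<close> is a round of the game whose cell fixes the move at
    level \<beta>; by \<open>coh\<close> any such round gives the same move.\<close>
  then obtain a where a: "\<And>\<beta>. \<beta> \<in> D \<Longrightarrow> a \<beta> \<in> \<Gamma> \<and> \<beta> \<in> under \<kappa> (\<xi> (a \<beta>))" by metis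
  have down: "\<gamma> \<in> under \<kappa> (\<xi> \<alpha>)" if "\<beta> \<in> under \<kappa> (\<xi> \<alpha>)" "\<gamma> \<in> under \<kappa> \<beta>" for \<alpha> \<beta> \<gamma>
    using that by (auto simp: under_def dest: kappa_trans)
  have "ofilter \<kappa> D"
    unfolding ofilter_def D_def using down under_Field by blast
  moreover have "D \<noteq> {}"
    using assms(1) \<xi> in_under by (auto simp: D_def)
  moreover have "plays \<gamma> (x (a \<gamma>)) = plays \<gamma> (x (a \<beta>))" if "\<beta> \<in> D" "\<gamma> \<in> under \<kappa> \<beta>" for \<beta> \<gamma>
  proof -
    have "\<gamma> \<in> under \<kappa> (\<xi> (a \<beta>))" using a[OF that(1)] down that(2) by blast
    moreover from this have "\<gamma> \<in> D" using a[OF that(1)] by (auto simp: D_def)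
    ultimately show ?thesis using coh a that(1) by blast
  qed
  ultimately obtain z where z: "z \<in> topspace X" "\<And>\<beta>. \<beta> \<in> D \<Longrightarrow> plays \<beta> z = plays \<beta> (x (a \<beta>))"
    using branch_nonempty[of D "\<lambda>\<beta>. x (a \<beta>)"] a x by blast
  have "z \<in> cell (\<xi> \<alpha>) (x \<alpha>)" if \<alpha>: "\<alpha> \<in> \<Gamma>" for \<alpha>
  proof -
    have "plays \<beta> z = plays \<beta> (x \<alpha>)" if "\<beta> \<in> under \<kappa> (\<xi> \<alpha>)" for \<beta>
    proof -
      have "\<beta> \<in> D" using that \<alpha> by (auto simp: D_def)
      then show ?thesis using z(2) coh[OF _ \<alpha> _ that] a by metis
    qed
    then show ?thesis using z(1) by (simp add: cell_def)
  qed
  then show ?thesis by blast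
qed

section \<open>The memoryless answer of player II\<close>

text \<open>Level and basic set are chosen as a pair, so that the basic set played by II is tied to
  a witnessing cell.\<close>

definition fits :: "'a \<Rightarrow> 'a set \<Rightarrow> 'k \<times> 'k \<Rightarrow> bool" where
  "fits x U = (\<lambda>(\<xi>, \<eta>). \<xi> \<in> Field \<kappa> \<and> x \<in> c \<eta> \<and> c \<eta> \<subseteq> cell \<xi> x \<and> cell \<xi> x \<subseteq> U)"

text \<open>Cells need not be intersections of few open sets, so II cannot play the cell itself.\<close>

definition tact :: "'a \<Rightarrow> 'a set \<Rightarrow> 'a set" where
  "tact x U = c (snd (SOME p. fits x U p))"

lemma tact_fits:
  assumes "kopen U" "x \<in> U"
  shows "\<exists>\<xi>. \<xi> \<in> Field \<kappa> \<and> x \<in> tact x U \<and> tact x U \<subseteq> cell \<xi> x \<and> cell \<xi> x \<subseteq> U"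
proof -
  obtain \<xi> where \<xi>: "\<xi> \<in> Field \<kappa>" "cell \<xi> x \<subseteq> U"
    using cell_neighbourhood[OF assms] .
  have x: "x \<in> topspace X" using assms kopen_subset by blast
  then have "x \<in> cell \<xi> x" by (simp add: cell_def)
  then obtain \<eta> where "x \<in> c \<eta>" "c \<eta> \<subseteq> cell \<xi> x"
    using kopen_base plays_good[OF \<xi>(1) x] by blast
  then have "fits x U (\<xi>, \<eta>)" using \<xi> by (simp add: fits_def)
  then have "fits x U (SOME p. fits x U p)" by (rule someI)
  then show ?thesis by (auto simp: fits_def tact_def case_prod_beta)
qed

text \<open>Every answer leaves a cell between \<open>V \<alpha>\<close> and
  \<open>U \<alpha>\<close>. Later points stay in \<open>V \<alpha>\<close>, hence in this cell, so
  \<open>nested_cells\<close> gives a point in all the cells and thus in all sets of I.\<close>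

lemma tact_winning: "winning_strategy \<kappa> X (\<lambda>\<alpha> x U V. tact (x \<alpha>) (U \<alpha>))"
  unfolding winning_strategy_def
proof (intro allI impI, elim conjE)
  fix \<delta> x U V
  assume \<delta>: "ofilter \<kappa> \<delta>"
    and "\<forall>\<alpha>\<in>\<delta>. legal_I \<kappa> X x U V \<alpha> \<and> follows \<kappa> (\<lambda>\<alpha> x U V. tact (x \<alpha>) (U \<alpha>)) x U V \<alpha>"
  then have I: "legal_I \<kappa> X x U V \<alpha>"
    and II: "follows \<kappa> (\<lambda>\<alpha> x U V. tact (x \<alpha>) (U \<alpha>)) x U V \<alpha>" if "\<alpha> \<in> \<delta>" for \<alpha>
    using that by blast+
  have F: "\<alpha> \<in> Field \<kappa>" if "\<alpha> \<in> \<delta>" for \<alpha>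
    using \<delta> that by (auto simp: ofilter_def)
  have V: "V \<alpha> = tact (x \<alpha>) (U \<alpha>)" if "\<alpha> \<in> \<delta>" for \<alpha>
    using II[OF that] in_under[OF F[OF that]] by (simp add: follows_def)
  have xU: "x \<alpha> \<in> U \<alpha>" if "\<alpha> \<in> \<delta>" for \<alpha>
    using I[OF that] by (simp add: legal_I_def)
  have kU: "kopen (U \<alpha>)" if \<alpha>: "\<alpha> \<in> \<delta>" for \<alpha>
  proof -
    obtain G where G: "short_Inter_open \<kappa> X G" "U \<alpha> = G \<inter> (\<Inter>\<beta>\<in>underS \<kappa> \<alpha>. V \<beta>)"
      using I[OF \<alpha>] by (auto simp: legal_I_def)
    \<comment> \<open>\<open>G\<close> lies in the space, so \<open>topspace X\<close> can be
      inserted to reach the form of \<open>kopen_INT\<close>, which also covers the first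
      round.\<close>
    then have eq: "U \<alpha> = G \<inter> (topspace X \<inter> (\<Inter>\<beta>\<in>underS \<kappa> \<alpha>. V \<beta>))"
      using short_Inter_open_subset by blast
    have "\<beta> \<in> \<delta>" if "\<beta> \<in> underS \<kappa> \<alpha>" for \<beta>
      using \<delta> \<alpha> underS_subset_under[OF that] by (auto simp: ofilter_def)
    then have "kopen (V \<beta>)" if "\<beta> \<in> underS \<kappa> \<alpha>" for \<beta>
      using V that kopen_c by (simp add: tact_def)
    then show ?thesis
      unfolding eq by (intro kopen_Int kopen_short[OF G(1)] kopen_INT card_underS F \<alpha>)
  qed
  \<comment> \<open>The levels are recovered afterwards for the analysis of the play; the answer of
    II does not refer to earlier ones.\<close>
  have "\<forall>\<alpha>\<in>\<delta>. \<exists>\<xi>. \<xi> \<in> Field \<kappa> \<and> x \<alpha> \<in> V \<alpha> \<and> V \<alpha> \<subseteq> cell \<xi> (x \<alpha>) \<and> cell \<xi> (x \<alpha>) \<subseteq> U \<alpha>"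
    using tact_fits kU xU V by simp
  then obtain \<xi> where \<xi>: "\<And>\<alpha>. \<alpha> \<in> \<delta> \<Longrightarrow>
      \<xi> \<alpha> \<in> Field \<kappa> \<and> x \<alpha> \<in> V \<alpha> \<and> V \<alpha> \<subseteq> cell (\<xi> \<alpha>) (x \<alpha>) \<and> cell (\<xi> \<alpha>) (x \<alpha>) \<subseteq> U \<alpha>"
    by metis
  have "legal_II \<kappa> X x U V \<alpha>" if "\<alpha> \<in> \<delta>" for \<alpha>
  proof -
    have "V \<alpha> = V \<alpha> \<inter> U \<alpha>" using \<xi>[OF that] by blast
    moreover have "short_Inter_open \<kappa> X (V \<alpha>)" using V[OF that] c_open by (simp add: tact_def)
    ultimately show ?thesis unfolding legal_II_def using \<xi>[OF that] by blast
  qed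
  moreover have "(\<Inter>\<alpha>\<in>\<gamma>. U \<alpha>) \<noteq> {}" if \<gamma>: "\<gamma> \<subseteq> \<delta>" "limit_segment \<kappa> \<gamma>" for \<gamma>
  proof -
    have "(\<Inter>\<alpha>\<in>\<gamma>. cell (\<xi> \<alpha>) (x \<alpha>)) \<noteq> {}"
    proof (rule nested_cells)
      show "\<gamma> \<noteq> {}" using \<gamma>(2) by (simp add: limit_segment_def)
      show "\<gamma> \<subseteq> Field \<kappa>" using \<gamma>(1) F by blast
      show "x \<alpha> \<in> topspace X" if "\<alpha> \<in> \<gamma>" for \<alpha>
        using that \<gamma>(1) kU xU kopen_subset by blast
      show "\<xi> \<alpha> \<in> Field \<kappa>" if "\<alpha> \<in> \<gamma>" for \<alpha>
        using that \<gamma>(1) \<xi> by blast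
      show "x \<alpha>' \<in> cell (\<xi> \<alpha>) (x \<alpha>)" if "\<alpha>' \<in> \<gamma>" "\<alpha> \<in> \<gamma>" "\<alpha> \<in> underS \<kappa> \<alpha>'" for \<alpha> \<alpha>'
      proof -
        \<comment> \<open>Here the rule that I moves inside all earlier answers of II forces the
          play onto one branch.\<close>
        have "U \<alpha>' \<subseteq> V \<alpha>"
          using I[of \<alpha>'] that \<gamma>(1) by (auto simp: legal_I_def)
        then show ?thesis using xU[of \<alpha>'] \<xi>[of \<alpha>] that \<gamma>(1) by blast
      qed
    qed
    then show ?thesis using \<xi> \<gamma>(1) by blast
  qed
  ultimately show "(\<forall>\<alpha>\<in>\<delta>. legal_II \<kappa> X x U V \<alpha>) \<and>
      (\<forall>\<gamma>\<subseteq>\<delta>. limit_segment \<kappa> \<gamma> \<longrightarrow> (\<Inter>\<alpha>\<in>\<gamma>. U \<alpha>) \<noteq> {})"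
    by blast
qed

end

theorem theorem4p5:
  fixes \<kappa> :: "'k rel" and X :: "'a topology"
  assumes "Card_order \<kappa>" and "natLeq <o \<kappa>" and "regularCard \<kappa>"
    and "|short_sequences \<kappa>| =o \<kappa>"
    and "Hausdorff_space X" and "regular_space X"
    and "weight_le X \<kappa>"
    and "dynamic_strong_Choquet \<kappa> X"
  shows "\<exists>\<sigma>. stationary \<kappa> \<sigma> \<and> winning_strategy \<kappa> X \<sigma>"
proof -
  have cinf: "Cinfinite \<kappa>"
    using assms(1) cinfinite_mono[OF ordLess_imp_ordLeq[OF assms(2)] natLeq_cinfinite] by simp
  obtain \<sigma> where \<sigma>: "winning_strategy \<kappa> X \<sigma>"
    using assms(8) by (auto simp: dynamic_strong_Choquet_def)
  obtain c :: "'k \<Rightarrow> 'a set" where c: "\<And>\<xi>. short_Inter_open \<kappa> X (c \<xi>)" "\<And>\<xi>. closedin X (c \<xi>)"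
    "\<And>G x. short_Inter_open \<kappa> X G \<Longrightarrow> x \<in> G \<Longrightarrow> \<exists>\<xi>\<in>Field \<kappa>. x \<in> c \<xi> \<and> c \<xi> \<subseteq> G"
    using closed_short_base[OF cinf assms(2,3,4,6,7)] by blast
  interpret choquet_base \<kappa> X c \<sigma>
    using cinf assms(3) c \<sigma> by unfold_locales
  show ?thesis
    using tact_winning unfolding stationary_def by (intro exI conjI) auto
qed

end
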